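(* Let $C$ be a smooth projective curve of genus $2$ defined over $\mathbb{Q}$, and assume that $C$ has exactly two $\mathbb{Q}$-rational Weierstrass points and a quadratic Weierstrass point. If $C$ is described by a globally minimal Weierstrass equation of the form $E:\ y^2+Q(x)y=P(x)$ with $P,Q\in\mathbb{Z}[x]$, $\deg Q(x)\le 2$ and $P(x)$ monic of degree $5$, then $|\Delta_E|$ is never an odd prime.
   Context: A Weierstrass equation of a genus two curve $C$ over $\mathbb{Q}$ is an equation $y^2+Q(x)y=P(x)$ with $P,Q\in\mathbb{Q}[x]$, $\deg Q\le 3$, $\deg P\le 6$, such that $x$ generates the subfield of $\mathbb{Q}(C)$ fixed by the hyperelliptic involution and $\mathbb{Q}(C)=\mathbb{Q}(x)[y]$. Its discriminant is $\Delta_E=2^{-12}\operatorname{disc}(4P(x)+Q(x)^2)$. A Weierstrass equation is integral if $P,Q\in\mathbb{Z}[x]$; it is minimal at a prime $p$ if it is integral and the $p$-adic valuation of its discriminant is smallest among all integral Weierstrass equations describing $C$ over $\mathbb{Z}_p$; it is globally minimal if it is minimal at every prime. Weierstrass points of $C$ are the fixed points of the hyperelliptic involution; $\mathbb{Q}$-rational ones are those defined over $\mathbb{Q}$, and a quadratic Weierstrass point is one defined over a quadratic extension of $\mathbb{Q}$ but not over $\mathbb{Q}$ (equivalently, in a model $y^2=xF(x)$ with $F$ monic quartic, $F$ is a product of two irreducible quadratics over $\mathbb{Q}$). *)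

theory Defs
  imports "HOL-Computational_Algebra.Computational_Algebra" "Subresultants.Resultant_Prelim"
begin

(* Weierstrass equations y^2 + Q(x) y = P(x) over Q are represented by pairs of
   rational polynomials (P, Q).  F = 4P + Q^2 is the associated sextic. *)

definition wF :: "rat poly \<Rightarrow> rat poly \<Rightarrow> rat poly" where
  "wF P Q = Polynomial.smult 4 P + Q ^ 2"

definition poly_disc :: "rat poly \<Rightarrow> rat" where
  "poly_disc f = (-1) ^ (degree f * (degree f - 1) div 2) * resultant f (pderiv f) / lead_coeff f"

(* discriminant of F viewed as a binary form of degree 6
   (a root at infinity when degree F < 6) *)
definition disc6 :: "rat poly \<Rightarrow> rat" where
  "disc6 F = (if degree F = 6 then poly_disc F
              else if degree F = 5 then lead_coeff F ^ 2 * poly_disc F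
              else 0)"

definition wdisc :: "rat poly \<Rightarrow> rat poly \<Rightarrow> rat" where
  "wdisc P Q = disc6 (wF P Q) / 2 ^ 12"

(* (c x + d)^n g((a x + b)/(c x + d)) *)
definition homsub :: "nat \<Rightarrow> rat \<Rightarrow> rat \<Rightarrow> rat \<Rightarrow> rat \<Rightarrow> rat poly \<Rightarrow> rat poly" where
  "homsub n a b c d g = (\<Sum>i\<le>n. Polynomial.smult (Polynomial.coeff g i) ([:b, a:] ^ i * [:d, c:] ^ (n - i)))"

(* (P',Q') is obtained from (P,Q) by a change of variables
   x = (a x' + b)/(c x' + d),  y = (e y' + H(x'))/(c x' + d)^3,
   i.e. both Weierstrass equations describe the same curve over Q *)
definition weq_equiv :: "rat poly \<Rightarrow> rat poly \<Rightarrow> rat poly \<Rightarrow> rat poly \<Rightarrow> bool" where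
  "weq_equiv P Q P' Q' \<longleftrightarrow>
     (\<exists>a b c d e H. a * d - b * c \<noteq> 0 \<and> e \<noteq> 0 \<and> degree H \<le> 3 \<and>
        Q' = Polynomial.smult (1 / e) (Polynomial.smult 2 H + homsub 3 a b c d Q) \<and>
        wF P' Q' = Polynomial.smult (1 / e ^ 2) (homsub 6 a b c d (wF P Q)))"

definition weq :: "rat poly \<Rightarrow> rat poly \<Rightarrow> bool" where
  "weq P Q \<longleftrightarrow> degree P \<le> 6 \<and> degree Q \<le> 3"

definition p_integral :: "int \<Rightarrow> rat \<Rightarrow> bool" where
  "p_integral p r \<longleftrightarrow> \<not> p dvd snd (quotient_of r)"

definition rat_val :: "int \<Rightarrow> rat \<Rightarrow> int" where
  "rat_val p r = int (multiplicity p (fst (quotient_of r))) - int (multiplicity p (snd (quotient_of r)))"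

definition p_integral_poly :: "int \<Rightarrow> rat poly \<Rightarrow> bool" where
  "p_integral_poly p f \<longleftrightarrow> (\<forall>i. p_integral p (coeff f i))"

definition minimal_at :: "int \<Rightarrow> int poly \<Rightarrow> int poly \<Rightarrow> bool" where
  "minimal_at p P Q \<longleftrightarrow>
     (\<forall>P' Q'. weq P' Q' \<and> weq_equiv (of_int_poly P) (of_int_poly Q) P' Q' \<and>
        p_integral_poly p P' \<and> p_integral_poly p Q' \<longrightarrow>
        rat_val p (wdisc P' Q') \<ge> rat_val p (wdisc (of_int_poly P) (of_int_poly Q)))"

definition globally_minimal :: "int poly \<Rightarrow> int poly \<Rightarrow> bool" where
  "globally_minimal P Q \<longleftrightarrow> (\<forall>p. prime p \<longrightarrow> minimal_at p P Q)"

(* Weierstrass points: affine ones have x-coordinate a root of F = 4P+Q^2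
   (and y = -Q(x)/2); there is one at infinity iff degree F < 6.
   Number of Q-rational Weierstrass points: *)
definition num_rat_weierstrass :: "rat poly \<Rightarrow> rat poly \<Rightarrow> nat" where
  "num_rat_weierstrass P Q =
     card {r :: rat. poly (wF P Q) r = 0} + (if degree (wF P Q) < 6 then 1 else 0)"

(* existence of a Weierstrass point defined over a quadratic field, not over Q *)
definition has_quadratic_weierstrass :: "rat poly \<Rightarrow> rat poly \<Rightarrow> bool" where
  "has_quadratic_weierstrass P Q \<longleftrightarrow>
     (\<exists>g :: rat poly. irreducible g \<and> degree g = 2 \<and> g dvd wF P Q)"

end

theory Submission
  imports Defs "Subresultants.Subresultant"
begin

text \<open>
  Write \<open>F = 4P + Q\<^sup>2\<close>. By Gauss's lemma \<open>F = L G H\<close> over the integers with \<open>L\<close> linear and \<open>G\<close>, \<open>H\<close>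
  quadratic without rational roots, and
  \<open>2\<^sup>8 \<Delta> = disc(G) disc(H) (Res(L,G) Res(L,H) Res(G,H))\<^sup>2\<close>. If \<open>\<Delta>\<close> is an odd prime up to sign, the
  three resultants and one of the two discriminants are, up to sign, powers of two of bounded
  size. The leading coefficient \<open>t\<close> of \<open>L\<close> divides 4. For \<open>t = 2\<close> the equation \<open>F(s/2) = 0\<close>
  fails 2-adically. For \<open>t = 4\<close> the resultants with \<open>L\<close> are units, so \<open>1 + 4D\<close> is a square for
  a discriminant \<open>D\<close> dividing 256, which never happens. For \<open>t = 1\<close> translate the root to 0; then
  the congruence \<open>F \<equiv> Q\<^sup>2\<close> mod 4 forces the leading coefficients of \<open>G\<close> and \<open>H\<close> to be 1 and 4, the
  discriminant of \<open>G\<close> to be -4 or -16, and \<open>Res(G,H)\<close>, a sum of two squares, to be too large.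
\<close>

section \<open>Resultants as products over roots\<close>

text \<open>One Euclidean step: adding a multiple of \<open>G\<close> to \<open>F\<close> affects
  the resultant only through the drop in degree, which costs powers of the leading coefficient of
  \<open>G\<close>. At index 0 the subresultant identity takes a separate form when the remainder is
  constant.\<close>

lemma resultant_mod_right:
  fixes G F H :: "'a :: idom poly"
  assumes eq: "F + B * G = H" and le: "degree G \<le> degree F" and less: "degree H < degree G"
  shows "resultant G F = lead_coeff G ^ (degree F - degree H) * resultant G H"
proof -
  have "resultant F G = (-1) ^ (degree F * degree G) *
      (lead_coeff G ^ (degree F - degree H) * resultant G H)"
  proof (cases "degree H = 0")
    case True
    then obtain h where H: "H = [:h:]" by (metis degree_eq_zeroE)
    have "[:resultant F G:] = Polynomial.smult ((-1) ^ (degree F * degree G) * lead_coeff G ^ degree F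
        * h ^ (degree G - 1)) H"
      using BT_lemma_1_13[OF eq le] less True H
      by (simp add: subresultant_resultant[symmetric])
    with less H show ?thesis
      by (simp add: power_eq_if[of h "degree G"] mult_ac)
  next
    case False
    have "[:resultant F G:] = [:(-1) ^ (degree F * degree G) *
        (lead_coeff G ^ (degree F - degree H) * resultant G H):]"
      using BT_lemma_1_12[OF eq le, of 0] less False
      by (simp add: subresultant_resultant mult_ac)
    then show ?thesis by simp
  qed
  then show ?thesis
    by (subst resultant_swap)
       (simp add: mult.assoc[symmetric] power_add[symmetric] mult.commute[of "degree G"]
             flip: power_add mult_2)
qed

lemma degree_prod_linear: "degree (\<Prod>x\<in>#A. [:-x, 1 :: 'a :: idom:]) = size A"
  and lead_coeff_prod_linear: "lead_coeff (\<Prod>x\<in>#A. [:-x, 1 :: 'a :: idom:]) = 1"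
proof (induction A)
  case (add y A)
  {
    case 1
    have "(\<Prod>x\<in>#A. [:-x, 1:]) \<noteq> 0" using add by auto
    then have "degree ([:-y, 1:] * (\<Prod>x\<in>#A. [:-x, 1:])) = Suc (size A)"
      using add by (subst degree_mult_eq) auto
    then show ?case by simp
  next
    case 2
    have "lead_coeff ([:-y, 1:] * (\<Prod>x\<in>#A. [:-x, 1:])) = 1"
      using add by (subst lead_coeff_mult) auto
    then show ?case by simp
  }
qed auto

text \<open>Poisson's product formula, by Euclidean descent on the number of roots: \<open>F\<close>
  is reduced modulo \<open>G\<close>, the remainder is factored over the algebraically closed field,
  and the induction hypothesis applies once the two arguments are swapped.\<close>

lemma resultant_smult_prod_linear:
  fixes c :: "'a :: alg_closed_field"
  assumes "c \<noteq> 0"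
  shows "resultant (Polynomial.smult c (\<Prod>x\<in>#A. [:-x, 1:])) F =
    c ^ degree F * (\<Prod>x\<in>#A. poly F x)"
  using assms
proof (induction "size A" arbitrary: A F c rule: less_induct)
  case less
  define G where "G = Polynomial.smult c (\<Prod>x\<in>#A. [:-x, 1:])"
  have degG: "degree G = size A"
    using less.prems degree_prod_linear[of A] by (simp add: G_def)
  have lcG: "lead_coeff G = c"
    using lead_coeff_prod_linear[of A] by (simp add: G_def lead_coeff_smult)
  have rootG: "poly G x = 0" if "x \<in># A" for x
    using that by (auto simp: G_def poly_prod_mset prod_mset_zero_iff)
  \<comment> \<open>A nonzero \<open>H\<close> has fewer roots than \<open>G\<close>, so the
    induction hypothesis evaluates \<open>resultant H G\<close>. Both orders yield the double
    product of root differences; reversing the differences produces exactly the sign of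
    \<open>resultant_swap\<close>.\<close>
  have small: "resultant G H = c ^ degree H * (\<Prod>x\<in>#A. poly H x)"
    if "degree H < degree G" for H
  proof (cases "H = 0")
    case True
    then show ?thesis using that degG by (auto simp: prod_mset_constant)
  next
    case False
    from alg_closed_imp_factorization[OF False] obtain B where
      B: "size B = degree H" "H = Polynomial.smult (lead_coeff H) (\<Prod>x\<in>#B. [:-x, 1:])" by blast
    define h where "h = lead_coeff H"
    have h0: "h \<noteq> 0" using False by (simp add: h_def)
    have H: "H = Polynomial.smult h (\<Prod>x\<in>#B. [:-x, 1:])" using B(2) by (simp add: h_def)
    have polyH: "poly H x = h * (\<Prod>y\<in>#B. x - y)" for x
      by (subst H) (simp add: poly_prod_mset)
    have polyG: "poly G y = c * (\<Prod>x\<in>#A. y - x)" for y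
      by (simp add: G_def poly_prod_mset)
    have "(\<Prod>y\<in>#B. \<Prod>x\<in>#A. y - x) = (\<Prod>y\<in>#B. \<Prod>x\<in>#A. (-1) * (x - y))" by simp
    also have "\<dots> = (-1) ^ (size A * size B) * (\<Prod>y\<in>#B. \<Prod>x\<in>#A. x - y)"
      by (simp only: prod_mset.distrib prod_mset_constant power_mult)
    also have "(\<Prod>y\<in>#B. \<Prod>x\<in>#A. x - y) = (\<Prod>x\<in>#A. \<Prod>y\<in>#B. x - y)"
      by (rule prod_mset.swap)
    finally have swap: "(\<Prod>y\<in>#B. \<Prod>x\<in>#A. y - x) =
      (-1) ^ (size A * size B) * (\<Prod>x\<in>#A. \<Prod>y\<in>#B. x - y)" .
    have "resultant H G = h ^ degree G * (\<Prod>y\<in>#B. poly G y)"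
      using less.hyps[of B h G] that degG B(1) h0 H by simp
    also have "\<dots> = h ^ degree G * (c ^ degree H * ((-1) ^ (degree G * degree H) *
        (\<Prod>x\<in>#A. \<Prod>y\<in>#B. x - y)))"
      by (simp add: polyG prod_mset.distrib prod_mset_constant B(1) swap degG)
    also have "\<dots> = (-1) ^ (degree G * degree H) * (c ^ degree H *
        (h ^ degree G * (\<Prod>x\<in>#A. \<Prod>y\<in>#B. x - y)))"
      by (simp only: mult_ac)
    also have "h ^ degree G * (\<Prod>x\<in>#A. \<Prod>y\<in>#B. x - y) = (\<Prod>x\<in>#A. poly H x)"
      by (simp add: polyH prod_mset.distrib prod_mset_constant degG)
    finally show ?thesis
      by (subst resultant_swap) (simp add: mult.assoc[symmetric] flip: power_add)
  qed
  show ?case unfolding G_def[symmetric]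
  proof (cases "degree F < degree G \<or> degree G = 0")
    case True
    then show "resultant G F = c ^ degree F * (\<Prod>x\<in>#A. poly F x)"
    proof
      assume 0: "degree G = 0"
      then obtain g where "G = [:g:]" by (metis degree_eq_zeroE)
      with lcG have "G = [:c:]" by simp
      with 0 degG show ?thesis by simp
    qed (rule small)
  next
    case False
    define H where "H = F mod G"
    have eq: "F + (- (F div G)) * G = H" by (simp add: H_def minus_div_mult_eq_mod)
    have "G \<noteq> 0" using False by auto
    then have less': "degree H < degree G"
      using False degree_mod_less'[of G F] by (cases "H = 0") (auto simp: H_def)
    have FH: "poly H x = poly F x" if "x \<in># A" for x
      using rootG[OF that] by (simp flip: eq)
    have "resultant G F = c ^ (degree F - degree H) * (c ^ degree H * (\<Prod>x\<in>#A. poly H x))"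
      using resultant_mod_right[OF eq _ less'] False small[OF less'] lcG by simp
    also have "(\<Prod>x\<in>#A. poly H x) = (\<Prod>x\<in>#A. poly F x)"
      using FH by (metis (no_types, lifting) image_mset_cong)
    finally show "resultant G F = c ^ degree F * (\<Prod>x\<in>#A. poly F x)"
      using less' False by (simp add: mult.assoc[symmetric] flip: power_add)
  qed
qed

section \<open>The discriminant of a product of one linear and two quadratic polynomials\<close>

text \<open>The coefficients are those of \<open>ax\<^sup>2 + bx + c\<close>, \<open>a'x\<^sup>2 + b'x + c'\<close> and \<open>lx + m\<close>, leading one first.\<close>

definition quad_disc :: "'a :: comm_ring_1 \<Rightarrow> 'a \<Rightarrow> 'a \<Rightarrow> 'a" where
  "quad_disc a b c = b\<^sup>2 - 4 * a * c"

definition quad_res :: "'a :: comm_ring_1 \<Rightarrow> 'a \<Rightarrow> 'a \<Rightarrow> 'a \<Rightarrow> 'a \<Rightarrow> 'a \<Rightarrow> 'a" where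
  "quad_res a b c a' b' c' = (a * c' - a' * c)\<^sup>2 - (a * b' - a' * b) * (b * c' - b' * c)"

definition lin_quad_res :: "'a :: comm_ring_1 \<Rightarrow> 'a \<Rightarrow> 'a \<Rightarrow> 'a \<Rightarrow> 'a \<Rightarrow> 'a" where
  "lin_quad_res l m a b c = a * m\<^sup>2 - b * l * m + c * l\<^sup>2"

lemma quadratic_splits:
  fixes a b c :: "'a :: alg_closed_field"
  assumes "a \<noteq> 0"
  obtains x y where "b = - a * (x + y)" "c = a * x * y"
proof -
  obtain x where x: "poly [:c, b, a:] x = 0"
    using alg_closed_imp_poly_has_root[of "[:c, b, a:]"] assms by auto
  define y where "y = - b / a - x"
  have b: "b = - a * (x + y)" using assms by (simp add: y_def field_simps)
  have "c = a * x * y" using x by (simp add: b algebra_simps)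
  with b show thesis by (rule that)
qed

text \<open>By the product formula each of the ten pairs of roots contributes two opposite
  differences, and the ten signs cancel. The exponent 9 is 4 from the degree of
  \<open>pderiv f\<close> plus 5 from its values at the roots.\<close>

lemma resultant_pderiv_split_quintic:
  fixes c r x y z w :: "'a :: {alg_closed_field, field_char_0}"
  assumes "c \<noteq> 0"
  defines "f \<equiv> Polynomial.smult c ([:-r, 1:] * [:-x, 1:] * [:-y, 1:] * [:-z, 1:] * [:-w, 1:])"
  shows "resultant f (pderiv f) = c ^ 9 * ((r - x)\<^sup>2 * (r - y)\<^sup>2 * (r - z)\<^sup>2 * (r - w)\<^sup>2 *
    (x - y)\<^sup>2 * (x - z)\<^sup>2 * (x - w)\<^sup>2 * (y - z)\<^sup>2 * (y - w)\<^sup>2 * (z - w)\<^sup>2)"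
proof -
  have fA: "f = Polynomial.smult c (\<Prod>x\<in>#{#r, x, y, z, w#}. [:-x, 1:])"
    by (simp add: f_def mult.assoc del: mult_pCons_left mult_pCons_right)
  have "degree f = 5"
    using degree_prod_linear[of "{#r, x, y, z, w#}"] assms(1) by (simp add: fA)
  then have deg: "degree (pderiv f) = 4"
    by (simp add: degree_pderiv)
  have pd: "poly (pderiv f) r = c * ((r - x) * (r - y) * (r - z) * (r - w))"
    "poly (pderiv f) x = c * ((x - r) * (x - y) * (x - z) * (x - w))"
    "poly (pderiv f) y = c * ((y - r) * (y - x) * (y - z) * (y - w))"
    "poly (pderiv f) z = c * ((z - r) * (z - x) * (z - y) * (z - w))"
    "poly (pderiv f) w = c * ((w - r) * (w - x) * (w - y) * (w - z))"
    by (simp_all add: f_def pderiv_smult pderiv_mult pderiv_pCons del: mult_pCons_left mult_pCons_right)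
  have sq: "(u - v) * (v - u) = - ((u - v)\<^sup>2)" for u v :: 'a
    by (simp add: power2_eq_square algebra_simps)
  have "resultant f (pderiv f) = c ^ 4 * (\<Prod>x\<in>#{#r, x, y, z, w#}. poly (pderiv f) x)"
    unfolding deg[symmetric] by (subst (1) fA) (rule resultant_smult_prod_linear[OF assms(1)])
  also have "\<dots> = c ^ 9 * (((r - x) * (x - r)) * ((r - y) * (y - r)) * ((r - z) * (z - r)) *
    ((r - w) * (w - r)) * ((x - y) * (y - x)) * ((x - z) * (z - x)) * ((x - w) * (w - x)) *
    ((y - z) * (z - y)) * ((y - w) * (w - y)) * ((z - w) * (w - z)))"
    by (simp add: pd power_numeral_reduce mult_ac)
  finally show ?thesis by (simp only: sq) simp
qed

text \<open>Pairs of roots within one quadratic give the two discriminants; pairs from different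
  factors give the three resultants.\<close>

lemma resultant_pderiv_linear_quadratic_quadratic:
  fixes l m a b c a' b' c' :: "'a :: {alg_closed_field, field_char_0}"
  assumes "l \<noteq> 0" "a \<noteq> 0" "a' \<noteq> 0"
  defines "f \<equiv> [:m, l:] * [:c, b, a:] * [:c', b', a':]"
  shows "resultant f (pderiv f) = l * a * a' * (quad_disc a b c * quad_disc a' b' c' *
    (lin_quad_res l m a b c * lin_quad_res l m a' b' c' * quad_res a b c a' b' c')\<^sup>2)"
proof -
  from quadratic_splits[OF assms(2)] obtain x y where xy: "b = - a * (x + y)" "c = a * x * y" .
  from quadratic_splits[OF assms(3)] obtain z w where zw: "b' = - a' * (z + w)" "c' = a' * z * w" .
  define r where "r = - m / l"
  have m: "m = - l * r" using assms(1) by (simp add: r_def)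
  have f: "f = Polynomial.smult (l * a * a')
      ([:-r, 1:] * [:-x, 1:] * [:-y, 1:] * [:-z, 1:] * [:-w, 1:])"
    unfolding f_def xy zw m by (simp add: algebra_simps)
  have D: "quad_disc a b c = a\<^sup>2 * (x - y)\<^sup>2" "quad_disc a' b' c' = a'\<^sup>2 * (z - w)\<^sup>2"
    unfolding quad_disc_def xy zw by (simp_all add: power2_eq_square algebra_simps)
  have L: "lin_quad_res l m a b c = l\<^sup>2 * a * ((r - x) * (r - y))"
    "lin_quad_res l m a' b' c' = l\<^sup>2 * a' * ((r - z) * (r - w))"
    unfolding lin_quad_res_def xy zw m by (simp_all add: power2_eq_square algebra_simps)
  have R: "quad_res a b c a' b' c' = a\<^sup>2 * a'\<^sup>2 * ((x - z) * (x - w) * (y - z) * (y - w))"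
    unfolding quad_res_def xy zw by (simp add: power2_eq_square algebra_simps)
  have *: "l * a * a' \<noteq> 0" using assms by simp
  show ?thesis
    unfolding f resultant_pderiv_split_quintic[OF *] D L R
    by (simp add: power_mult_distrib power_numeral_reduce mult_ac)
qed

text \<open>The product formula wants split quadratics, so the identity is pulled back from the
  complex numbers along the injective map \<open>of_rat\<close>. In degree 5 the sign in
  \<open>poly_disc\<close> is \<open>(-1) ^ 10\<close>.\<close>

lemma poly_disc_linear_quadratic_quadratic:
  fixes l m a b c a' b' c' :: rat
  assumes "l \<noteq> 0" "a \<noteq> 0" "a' \<noteq> 0"
  defines "f \<equiv> [:m, l:] * [:c, b, a:] * [:c', b', a':]"
  shows "poly_disc f = quad_disc a b c * quad_disc a' b' c' *
    (lin_quad_res l m a b c * lin_quad_res l m a' b' c' * quad_res a b c a' b' c')\<^sup>2"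
proof -
  let ?h = "of_rat :: rat \<Rightarrow> complex"
  define F where "F = [:?h m, ?h l:] * [:?h c, ?h b, ?h a:] * [:?h c', ?h b', ?h a':]"
  have F: "map_poly ?h f = F" unfolding f_def F_def
    by (simp add: of_rat_hom.map_poly_pCons_hom of_rat_add of_rat_mult)
  have lc: "lead_coeff f = l * a * a'" and deg: "degree f = 5"
    using assms(1-3) unfolding f_def by (simp_all add: lead_coeff_mult degree_mult_eq)
  have "?h (resultant f (pderiv f)) = resultant F (pderiv F)"
    unfolding F[symmetric] of_rat_hom.map_poly_pderiv[symmetric] by (simp only: of_rat_hom.resultant_hom)
  also have "\<dots> = ?h (l * a * a' * (quad_disc a b c * quad_disc a' b' c' *
    (lin_quad_res l m a b c * lin_quad_res l m a' b' c' * quad_res a b c a' b' c')\<^sup>2))"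
    unfolding F_def using assms(1-3)
    by (subst resultant_pderiv_linear_quadratic_quadratic)
       (simp_all add: quad_disc_def quad_res_def lin_quad_res_def of_rat_mult of_rat_diff of_rat_add of_rat_power)
  finally show ?thesis using assms(1-3) lc deg
    by (simp add: poly_disc_def)
qed

section \<open>Divisors of 256 times an odd prime\<close>

lemma dvd_256_cases:
  fixes d :: int
  assumes "d dvd 256"
  shows "\<bar>d\<bar> \<in> {1, 2, 4, 8, 16, 32, 64, 128, 256}"
proof -
  have "d dvd 2 ^ 8" using assms by simp
  then obtain i where i: "i \<le> 8" "\<bar>d\<bar> = 2 ^ i"
    using divides_primepow[of 2 d 8] by (auto simp: normalize_int_def)
  have "i \<in> {0, 1, 2, 3, 4, 5, 6, 7, 8}" using i(1) by auto
  then show ?thesis using i(2) by auto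
qed

lemma odd_dvd_256_mult:
  fixes a n :: int
  assumes "odd a" "a dvd 256 * n"
  shows "a dvd n"
proof -
  have "coprime a (2 ^ 8)" using assms(1) by (subst coprime_power_right_iff) auto
  then have "coprime a 256" by simp
  then show ?thesis using assms(2) coprime_dvd_mult_right_iff by blast
qed

text \<open>Since \<open>p * p\<close> does not divide \<open>256 * p\<close>, one of
  \<open>a\<close> and \<open>b\<close> is coprime to \<open>p\<close>, and being a divisor of
  \<open>256 * p\<close> it divides 256.\<close>

lemma dvd_256_of_prod:
  fixes a b s p :: int
  assumes p: "prime p" "odd p" and eq: "\<bar>a * b * s\<^sup>2\<bar> = 256 * p"
  shows "a dvd 256 \<or> b dvd 256"
proof -
  have "\<not> (p dvd a \<and> p dvd b)"
  proof
    assume "p dvd a \<and> p dvd b"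
    then have "p * p dvd a * b * s\<^sup>2" by (intro dvd_mult2 mult_dvd_mono) auto
    then have "p * p dvd 256 * p" by (subst eq[symmetric]) simp
    then have "p dvd 256 * 1" using p by (simp add: prime_gt_0_int)
    then have "p dvd 1" using odd_dvd_256_mult[OF p(2)] by blast
    then show False using p(1) not_prime_unit by blast
  qed
  moreover have "x dvd 256" if "\<not> p dvd x" "x dvd a * b * s\<^sup>2" for x
  proof -
    have "x dvd 256 * p" by (subst eq[symmetric]) (use that in simp)
    moreover have "coprime x p" using that(1) p(1)
      using coprime_commute prime_imp_coprime by blast
    ultimately show ?thesis using coprime_dvd_mult_left_iff by blast
  qed
  ultimately show ?thesis by (metis dvd_triv_left dvd_triv_right dvd_mult2)
qed

text \<open>An odd square dividing \<open>256 * p\<close> already divides the squarefree number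
  \<open>p\<close>.\<close>

lemma odd_square_dvd_256_prime:
  fixes a p :: int
  assumes "prime p" "odd a" "a\<^sup>2 dvd 256 * p"
  shows "\<bar>a\<bar> = 1"
proof -
  have "a\<^sup>2 dvd p" using assms odd_dvd_256_mult[of "a\<^sup>2" p] by simp
  show ?thesis
  proof (rule ccontr)
    assume "\<bar>a\<bar> \<noteq> 1"
    moreover have "a dvd p" using \<open>a\<^sup>2 dvd p\<close> by (metis dvd_mult_left power2_eq_square)
    ultimately have "\<bar>a\<bar> = p"
      using prime_int_iff[of p] assms(1) by (metis abs_dvd_iff abs_ge_zero)
    then have "p * p dvd p * 1" using \<open>a\<^sup>2 dvd p\<close>
      by (metis power2_abs power2_eq_square mult.right_neutral)
    then have "p dvd 1" using assms(1) by (simp add: prime_gt_0_int)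
    then show False using assms(1) not_prime_unit by blast
  qed
qed

lemma int_square_between:
  fixes x k :: int
  assumes "x\<^sup>2 = n" "k \<ge> 0" "k\<^sup>2 < n" "n < (k + 1)\<^sup>2"
  shows False
proof -
  have "k\<^sup>2 < \<bar>x\<bar>\<^sup>2" "\<bar>x\<bar>\<^sup>2 < (k + 1)\<^sup>2" using assms(1,3,4) by (simp_all only: power2_abs)
  then have "k < \<bar>x\<bar>" "\<bar>x\<bar> < k + 1"
    using assms(2) by (simp_all only: power2_less_imp_less abs_ge_zero add_nonneg_nonneg zero_le_one)
  then show False by simp
qed

lemma quad_disc_mod_4: "quad_disc a b c mod 4 \<in> {0, 1}" for a b c :: int
proof -
  have "b\<^sup>2 mod 4 \<in> {0, 1}"
  proof (cases "even b")
    case True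
    then show ?thesis by (auto elim!: evenE)
  next
    case False
    then obtain k where "b = 2 * k + 1" by (elim oddE)
    then have "b\<^sup>2 = 1 + 4 * (k\<^sup>2 + k)" by (simp add: power2_eq_square algebra_simps)
    then show ?thesis by (simp only: mod_mult_self2) simp
  qed
  moreover have "quad_disc a b c mod 4 = b\<^sup>2 mod 4"
  proof -
    have "quad_disc a b c = b\<^sup>2 + 4 * (- a * c)" by (simp add: quad_disc_def)
    then show ?thesis by (simp only: mod_mult_self2)
  qed
  ultimately show ?thesis by simp
qed

section \<open>Excluding a root with denominator 4 or 2\<close>

text \<open>The resultant with \<open>4x - s\<close> is a unit, which forces \<open>1 + 4D\<close> to be a square.\<close>

lemma quad_disc_not_dvd_256_denominator_4:
  fixes s a b c :: int
  assumes "a\<^sup>2 = 1" "odd s" "\<bar>lin_quad_res 4 (- s) a b c\<bar> = 1"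
  shows "\<not> quad_disc a b c dvd 256"
proof
  define D where "D = quad_disc a b c"
  assume "quad_disc a b c dvd 256"
  then have D: "\<bar>D\<bar> \<in> {1, 2, 4, 8, 16, 32, 64, 128, 256}"
    unfolding D_def by (rule dvd_256_cases)
  have Dmod: "D mod 4 \<in> {0, 1}" unfolding D_def by (rule quad_disc_mod_4)
  define A where "A = a * lin_quad_res 4 (- s) a b c"
  \<comment> \<open>Completing the square: as \<open>a\<^sup>2 = 1\<close>, the numbers
    \<open>u\<^sup>2\<close> and \<open>A\<close> differ by \<open>4 * D\<close>. The unit
    \<open>A\<close> is 1 modulo 4, hence equal to 1.\<close>
  define u where "u = s + 2 * a * b"
  have "A = s\<^sup>2 * a\<^sup>2 + 4 * (a * b * s + 4 * a * c)"
    by (simp add: A_def lin_quad_res_def power2_eq_square algebra_simps)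
  then have A: "A = s\<^sup>2 + 4 * (a * b * s + 4 * a * c)" using assms(1) by simp
  have "u\<^sup>2 - 4 * D = s\<^sup>2 + 4 * (a * b * s) + 4 * b\<^sup>2 * a\<^sup>2 - 4 * b\<^sup>2 + 16 * a * c"
    by (simp add: u_def D_def quad_disc_def power2_eq_square algebra_simps)
  then have uA: "u\<^sup>2 = A + 4 * D" using assms(1) A by simp
  have "\<bar>a\<bar> = 1" using assms(1) by (auto simp: power2_eq_1_iff)
  then have "\<bar>A\<bar> = 1" using assms(3) by (simp add: A_def abs_mult)
  moreover have "A mod 4 = 1"
  proof -
    obtain k where "s = 2 * k + 1" using assms(2) by (elim oddE)
    then have "A = 1 + 4 * (k\<^sup>2 + k + a * b * s + 4 * a * c)"
      unfolding A by (simp add: power2_eq_square algebra_simps)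
    then show ?thesis by (simp only: mod_mult_self2) simp
  qed
  ultimately have "A = 1" by (cases "A \<ge> 0") auto
  with uA have u: "u\<^sup>2 = 1 + 4 * D" by simp
  then have "D \<ge> 0" using zero_le_power2[of u] by linarith
  \<comment> \<open>The condition modulo 4 removes \<open>D = 2\<close>, the only listed value for
    which \<open>1 + 4 * D\<close> is a square, namely 9. The other values put it strictly between
    consecutive squares.\<close>
  with D Dmod have "D \<in> {1, 4, 8, 16, 32, 64, 128, 256}" by auto
  then show False using u
    int_square_between[of u 5 2] int_square_between[of u 17 4] int_square_between[of u 33 5]
    int_square_between[of u 65 8] int_square_between[of u 129 11] int_square_between[of u 257 16]
    int_square_between[of u 513 22] int_square_between[of u 1025 32]
    by auto
qed

text \<open>Both \<open>a\<close> and \<open>a'\<close> are units, so the resultants with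
  \<open>4x - s\<close> are odd. Their squares divide \<open>256 * p\<close>, so they are units, and
  then neither discriminant divides 256, although one of them must.\<close>

lemma no_root_denominator_4:
  fixes s a b c a' b' c' p :: int
  assumes p: "prime p" "odd p" and "a * a' = 1" "odd s"
    and eq: "\<bar>quad_disc a b c * quad_disc a' b' c' * (lin_quad_res 4 (- s) a b c *
      lin_quad_res 4 (- s) a' b' c' * quad_res a b c a' b' c')\<^sup>2\<bar> = 256 * p"
  shows False
proof -
  have aa: "a\<^sup>2 = 1 \<and> a'\<^sup>2 = 1" using \<open>a * a' = 1\<close> by (auto simp: zmult_eq_1_iff)
  have unit: "\<bar>lin_quad_res 4 (- s) x y z\<bar> = 1"
    if "x\<^sup>2 = 1" "(lin_quad_res 4 (- s) x y z)\<^sup>2 dvd 256 * p" for x y z :: int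
  proof (rule odd_square_dvd_256_prime[OF p(1) _ that(2)])
    have "odd x" using that(1) by (metis even_power odd_one zero_less_numeral)
    then show "odd (lin_quad_res 4 (- s) x y z)" using \<open>odd s\<close>
      by (simp add: lin_quad_res_def)
  qed
  have "(lin_quad_res 4 (- s) a b c)\<^sup>2 dvd 256 * p" "(lin_quad_res 4 (- s) a' b' c')\<^sup>2 dvd 256 * p"
    unfolding eq[symmetric] dvd_abs_iff power_mult_distrib by (simp_all add: dvd_mult dvd_mult2)
  with aa have "\<not> quad_disc a b c dvd 256" "\<not> quad_disc a' b' c' dvd 256"
    using quad_disc_not_dvd_256_denominator_4[OF _ \<open>odd s\<close> unit] by blast+
  then show False using dvd_256_of_prod[OF p eq] by blast
qed

text \<open>The equation is \<open>F(s/2) = 0\<close> multiplied by 32. It says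
  \<open>N\<^sup>2 = - 2 * M\<close> with \<open>M\<close> odd, but a square cannot have 2-adic
  valuation 1.\<close>

lemma no_root_denominator_2:
  fixes P0 P1 P2 P3 P4 q0 q1 q2 s :: int
  assumes "odd s"
    and "4 * (s ^ 5 + 2 * P4 * s ^ 4 + 4 * P3 * s ^ 3 + 8 * P2 * s\<^sup>2 + 16 * P1 * s + 32 * P0) +
      2 * (q2 * s\<^sup>2 + 2 * q1 * s + 4 * q0)\<^sup>2 = 0"
  shows False
proof -
  define N where "N = q2 * s\<^sup>2 + 2 * q1 * s + 4 * q0"
  define M where "M = s ^ 5 + 2 * P4 * s ^ 4 + 4 * P3 * s ^ 3 + 8 * P2 * s\<^sup>2 + 16 * P1 * s + 32 * P0"
  have MN: "N\<^sup>2 = - 2 * M" using assms(2) unfolding M_def N_def by linarith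
  have "odd M" using \<open>odd s\<close> by (simp add: M_def)
  have "even (N\<^sup>2)" using MN by simp
  then obtain k where "N = 2 * k" by auto
  with MN have "M = - 2 * k\<^sup>2" by (simp add: power2_eq_square)
  with \<open>odd M\<close> show False by simp
qed

section \<open>A root at 0 and quadratic factors with leading coefficients 1 and 4\<close>

text \<open>The odd discriminant \<open>E\<close> absorbs the prime \<open>p\<close>, so
  \<open>\<bar>D\<bar> * (m * R)\<^sup>2 = 16\<close>. This leaves two negative values of
  \<open>D\<close> and only small \<open>m\<close> and \<open>R\<close>, while \<open>R\<close> is a
  sum of two squares that cannot be that small.\<close>

lemma no_root_denominator_1_leads_1_4:
  fixes a b c d p :: int
  assumes p: "prime p" "odd p" and "odd c" and bd: "4 dvd b * d"
    and ns: "\<And>k. quad_disc 1 a b \<noteq> k\<^sup>2" "\<And>k. quad_disc 4 c d \<noteq> k\<^sup>2"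
    and eq: "\<bar>quad_disc 1 a b * quad_disc 4 c d * (b * d * quad_res 1 a b 4 c d)\<^sup>2\<bar> = 256 * p"
  shows False
proof -
  define D where "D = quad_disc 1 a b"
  define E where "E = quad_disc 4 c d"
  define R where "R = quad_res 1 a b 4 c d"
  obtain m where m: "b * d = 4 * m" using bd by (elim dvdE)
  have eq': "\<bar>D * E * (b * d * R)\<^sup>2\<bar> = 256 * p" using eq by (simp add: D_def E_def R_def)
  have E_odd: "odd E" using \<open>odd c\<close> by (simp add: E_def quad_disc_def)
  have "E dvd 256 * p" unfolding eq'[symmetric] by simp
  then have "E dvd p" using E_odd odd_dvd_256_mult by blast
  \<comment> \<open>The value -1 fails modulo 4, and 1 is a square.\<close>
  moreover have "\<bar>E\<bar> \<noteq> 1"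
  proof
    assume "\<bar>E\<bar> = 1"
    moreover have "E mod 4 \<in> {0, 1}" unfolding E_def by (rule quad_disc_mod_4)
    ultimately have "E = 1\<^sup>2" by (cases "E \<ge> 0") auto
    then show False using ns(2)[of 1] unfolding E_def by blast
  qed
  ultimately have "\<bar>E\<bar> = p"
    using prime_int_iff[of p] p(1) by (metis abs_dvd_iff abs_ge_zero)
  then have "p * (\<bar>D\<bar> * (b * d * R)\<^sup>2) = p * 256"
    using eq' by (simp add: abs_mult mult_ac)
  then have "\<bar>D\<bar> * (b * d * R)\<^sup>2 = 256" using p(1) by (simp add: prime_gt_0_int)
  then have DmR: "\<bar>D\<bar> * (m * R)\<^sup>2 = 16" unfolding m by (simp add: power_mult_distrib mult_ac)
  have "D dvd 16" using DmR by (metis abs_dvd_iff dvd_triv_left)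
  then have "D dvd 256" using dvd_trans[of D 16 256] by simp
  from dvd_256_cases[OF this] zdvd_imp_le[of "\<bar>D\<bar>" 16] \<open>D dvd 16\<close>
  have D_abs: "\<bar>D\<bar> \<in> {1, 2, 4, 8, 16}" by auto
  moreover have "D mod 4 \<in> {0, 1}" unfolding D_def by (rule quad_disc_mod_4)
  moreover have "\<bar>D\<bar> \<noteq> 8"
  proof
    assume "\<bar>D\<bar> = 8"
    with DmR have "(m * R)\<^sup>2 = 2" by simp
    then show False using int_square_between[of "m * R" 2 1] by simp
  qed
  moreover have "D \<noteq> 1\<^sup>2" "D \<noteq> 2\<^sup>2" "D \<noteq> 4\<^sup>2" unfolding D_def by (rule ns(1))+
  moreover have "D \<in> {1, - 1, 2, - 2, 4, - 4, 8, - 8, 16, - 16}"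
    using D_abs by (auto simp: abs_eq_iff')
  \<comment> \<open>Among the divisors of 16, the values 1, 4 and 16 are squares, 8 and -8 would
    make 2 a square, and -1, 2 and -2 fail modulo 4.\<close>
  ultimately have D: "D = - 4 \<or> D = - 16" by auto
  have Dab: "a\<^sup>2 = D + 4 * b" by (simp add: D_def quad_disc_def)
  \<comment> \<open>\<open>R\<close> is the norm from \<rat>(i) of the value of
    \<open>4x\<^sup>2 + cx + d\<close> at a root of \<open>x\<^sup>2 + ax + b\<close>. That root is
    \<open>-e + i\<close> for \<open>D = - 4\<close> and \<open>-e + 2i\<close> for
    \<open>D = - 16\<close>; real and imaginary parts of the value give the sums of two squares
    below.\<close>
  have R_eq: "R = (d - 4 * b)\<^sup>2 - (c - 4 * a) * (a * d - c * b)"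
    by (simp add: R_def quad_res_def)
  have "even D" using D by auto
  then have "even (a\<^sup>2)" using Dab by simp
  then obtain e where e: "a = 2 * e" by auto
  have le1: "\<bar>x\<bar> \<le> 1" if "x\<^sup>2 \<le> 2" for x :: int
    using that power_mono[of 2 "\<bar>x\<bar>" 2] by (cases "\<bar>x\<bar> \<le> 1") auto
  have le_of_dvd: "\<bar>x\<bar> \<le> n" if "x dvd n" "n > 0" for x n :: int
    using that zdvd_imp_le[of "\<bar>x\<bar>" n] by simp
  show False
  proof (cases "D = - 4")
    case True
    then have b: "b = e\<^sup>2 + 1" using Dab e by (simp add: power2_eq_square)
    have "(m * R)\<^sup>2 = 2\<^sup>2" using DmR True by simp
    then have mR: "m * R = 2 \<or> m * R = - 2" by (simp only: power2_eq_iff)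
    then have "m dvd 2" "R dvd 2" by (metis dvd_triv_left dvd_minus_iff, metis dvd_triv_right dvd_minus_iff)
    then have le2: "\<bar>m\<bar> \<le> 2" "\<bar>R\<bar> \<le> 2" by (auto dest: le_of_dvd)
    have "4 * m dvd 4 * 2" using \<open>m dvd 2\<close> by (intro mult_dvd_mono) auto
    moreover have "b dvd 4 * m" by (simp flip: m)
    ultimately have "b dvd 8" using dvd_trans[of b "4 * m" 8] by simp
    then have "b \<le> 8" by (simp add: zdvd_imp_le)
    then have "\<bar>e\<bar> \<le> 2"
      using power_mono[of 3 "\<bar>e\<bar>" 2] by (cases "\<bar>e\<bar> \<le> 2") (auto simp: b)
    then have "e \<in> {-2, -1, 0, 1, 2}" by auto
    moreover have "e \<noteq> 2" "e \<noteq> - 2" using \<open>b dvd 8\<close> by (auto simp: b)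
    ultimately consider "e = 0" | "e = 1" | "e = - 1" by auto
    then show False
    proof cases
      case 1
      then have "a = 0" "b = 1" "d = 4 * m" using m by (auto simp: e b)
      then have R: "R = (4 * m - 4)\<^sup>2 + c\<^sup>2" by (simp add: R_eq power2_eq_square)
      \<comment> \<open>A sum of two squares that is at most 2 has both entries of absolute value at
        most 1. The same bound is used in the other cases.\<close>
      then have "\<bar>4 * m - 4\<bar> \<le> 1" using le2 by (intro le1) (smt (verit) zero_le_power2)
      then have "m = 1" by auto
      then have "c\<^sup>2 = 2" using R mR zero_le_power2[of c] by auto
      then show False using int_square_between[of c 2 1] by simp
    next
      case 2
      then have "a = 2" "b = 2" "d = 2 * m" using m by (auto simp: e b)
      then have R: "R = (d - c)\<^sup>2 + (c - 8)\<^sup>2"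
        by (simp add: R_eq power2_eq_square algebra_simps)
      then have "\<bar>d - c\<bar> \<le> 1" "\<bar>c - 8\<bar> \<le> 1" using le2 by (intro le1; smt (verit) zero_le_power2)+
      \<comment> \<open>The bounds put \<open>c\<close> near 8 and \<open>d\<close> near
        \<open>c\<close>, whereas \<open>\<bar>d\<bar> \<le> 4\<close>.\<close>
      then show False using le2 \<open>d = 2 * m\<close> by auto
    next
      case 3
      then have "a = - 2" "b = 2" "d = 2 * m" using m by (auto simp: e b)
      then have R: "R = (d + c)\<^sup>2 + (c + 8)\<^sup>2"
        by (simp add: R_eq power2_eq_square algebra_simps)
      then have "\<bar>d + c\<bar> \<le> 1" "\<bar>c + 8\<bar> \<le> 1" using le2 by (intro le1; smt (verit) zero_le_power2)+
      then show False using le2 \<open>d = 2 * m\<close> by auto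
    qed
  next
    case False
    then have D16: "D = - 16" using D by simp
    then have b: "b = e\<^sup>2 + 4" using Dab e by (simp add: power2_eq_square)
    have "(m * R)\<^sup>2 = 1" using DmR D16 by simp
    then have mR: "m * R = 1 \<or> m * R = - 1" by (simp only: power2_eq_1_iff)
    then have "m dvd 1" "R dvd 1" by (metis dvd_triv_left dvd_minus_iff, metis dvd_triv_right dvd_minus_iff)
    then have le1': "\<bar>m\<bar> \<le> 1" "\<bar>R\<bar> \<le> 1" by (auto dest: le_of_dvd)
    have "4 * m dvd 4 * 1" using \<open>m dvd 1\<close> by (intro mult_dvd_mono) auto
    moreover have "b dvd 4 * m" by (simp flip: m)
    ultimately have "b dvd 4" using dvd_trans[of b "4 * m" 4] by simp
    then have "b \<le> 4" by (simp add: zdvd_imp_le)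
    then have "e = 0" using zero_le_power2[of e] by (simp add: b)
    then have "a = 0" "b = 4" "d = m" using m by (auto simp: e b)
    then have R: "R = (m - 16)\<^sup>2 + (2 * c)\<^sup>2" by (simp add: R_eq power2_eq_square)
    then have "\<bar>m - 16\<bar> \<le> 1" using le1' by (intro le1) (smt (verit) zero_le_power2)
    then show False using le1' by auto
  qed
qed

section \<open>An integral root: parity of the coefficients of Q\<close>

lemma poly_eq_of_degree_le_2: "degree p \<le> 2 \<Longrightarrow> p = [:coeff p 0, coeff p 1, coeff p 2:]"
  by (intro poly_eqI)
     (auto simp: coeff_pCons coeff_eq_0 numeral_2_eq_2 split: nat.splits)

lemma monic_quintic_eq:
  assumes "degree p = 5" "lead_coeff p = 1"
  shows "p = [:coeff p 0, coeff p 1, coeff p 2, coeff p 3, coeff p 4, 1:]"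
proof (intro poly_eqI)
  fix n :: nat
  consider "n = 0 \<or> n = 1 \<or> n = 2 \<or> n = 3 \<or> n = 4 \<or> n = 5" | "n > 5" by linarith
  then show "coeff p n = coeff [:coeff p 0, coeff p 1, coeff p 2, coeff p 3, coeff p 4, 1:] n"
  proof cases
    case 1
    then show ?thesis using assms by (auto simp: numeral_eq_Suc coeff_pCons)
  next
    case 2
    then show ?thesis using assms
      by (auto simp: coeff_eq_0 coeff_pCons split: nat.splits)
  qed
qed

text \<open>Gauss's lemma at the prime 2, written out in coefficients: a product of two polynomials
  over the field with two elements vanishes only if a factor does.\<close>

lemma even_product_coeffs:
  fixes g0 g1 g2 h0 h1 h2 :: int
  assumes "even (g0 * h0)" "even (g0 * h1 + g1 * h0)" "even (g0 * h2 + g1 * h1 + g2 * h0)"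
    "even (g1 * h2 + g2 * h1)" "even (g2 * h2)"
  shows "(even g0 \<and> even g1 \<and> even g2) \<or> (even h0 \<and> even h1 \<and> even h2)"
  using assms by (auto simp: even_add even_mult_iff)

lemma quad_res_commute: "quad_res a b c a' b' c' = quad_res a' b' c' a b c"
  by (simp add: quad_res_def power2_eq_square algebra_simps)

lemma quad_disc_uminus: "quad_disc (- a) (- b) (- c) = quad_disc a b c"
  by (simp add: quad_disc_def)

lemma quad_res_uminus: "quad_res (- a) (- b) (- c) (- a') (- b') (- c') = quad_res a b c a' b' c'"
  by (simp add: quad_res_def)

text \<open>Gauss's lemma at 2, applied twice, distributes the factor 4 over the two
  quadratics.\<close>

lemma dvd_disc_if_4_dvd_product_coeffs:
  fixes g0 g1 g2 h0 h1 h2 :: int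
  assumes "4 dvd g0 * h0" "4 dvd g0 * h1 + g1 * h0" "4 dvd g0 * h2 + g1 * h1 + g2 * h0"
    "4 dvd g1 * h2 + g2 * h1" "4 dvd g2 * h2"
  shows "2 ^ 16 dvd quad_disc g2 g1 g0 * quad_disc h2 h1 h0 *
    (g0 * h0 * quad_res g2 g1 g0 h2 h1 h0)\<^sup>2"
proof -
  \<comment> \<open>Homogeneity: the discriminants contribute \<open>(u * v)\<^sup>2\<close>, the
    squared constant terms \<open>(u * v)\<^sup>2\<close> and the squared resultant
    \<open>(u * v) ^ 4\<close>, in total \<open>4 ^ 8\<close>.\<close>
  have scale: "2 ^ 16 dvd quad_disc g2 g1 g0 * quad_disc h2 h1 h0 *
      (g0 * h0 * quad_res g2 g1 g0 h2 h1 h0)\<^sup>2"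
    if "u * v = 4" "g0 = u * x0" "g1 = u * x1" "g2 = u * x2" "h0 = v * y0" "h1 = v * y1" "h2 = v * y2"
    for u v x0 x1 x2 y0 y1 y2 g0 g1 g2 h0 h1 h2 :: int
  proof -
    have "quad_disc g2 g1 g0 = u\<^sup>2 * quad_disc x2 x1 x0" "quad_disc h2 h1 h0 = v\<^sup>2 * quad_disc y2 y1 y0"
      "quad_res g2 g1 g0 h2 h1 h0 = (u * v)\<^sup>2 * quad_res x2 x1 x0 y2 y1 y0"
      unfolding that(2-) by (simp_all add: quad_disc_def quad_res_def power2_eq_square algebra_simps)
    then have "quad_disc g2 g1 g0 * quad_disc h2 h1 h0 * (g0 * h0 * quad_res g2 g1 g0 h2 h1 h0)\<^sup>2 =
      (u * v) ^ 8 * (quad_disc x2 x1 x0 * quad_disc y2 y1 y0 * (x0 * y0 * quad_res x2 x1 x0 y2 y1 y0)\<^sup>2)"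
      unfolding that(2-) by (simp add: power_mult_distrib power_numeral_reduce mult_ac)
    then show ?thesis unfolding that(1) by simp
  qed
  \<comment> \<open>After one factor 2 is taken from the first quadratic, the second comes either
    from the same one or from the other: \<open>u\<close>, \<open>v\<close> are 4, 1 or 2,
    2.\<close>
  have half: "2 ^ 16 dvd quad_disc g2 g1 g0 * quad_disc h2 h1 h0 *
      (g0 * h0 * quad_res g2 g1 g0 h2 h1 h0)\<^sup>2"
    if "even g0" "even g1" "even g2" "4 dvd g0 * h0" "4 dvd g0 * h1 + g1 * h0"
      "4 dvd g0 * h2 + g1 * h1 + g2 * h0" "4 dvd g1 * h2 + g2 * h1" "4 dvd g2 * h2"
    for g0 g1 g2 h0 h1 h2 :: int
  proof -
    from that(1-3) obtain x0 x1 x2 where x: "g0 = 2 * x0" "g1 = 2 * x1" "g2 = 2 * x2"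
      by (elim evenE)
    have 2: "even n" if "4 dvd m" "m = 2 * n" for m n :: int using that by presburger
    have "(even x0 \<and> even x1 \<and> even x2) \<or> (even h0 \<and> even h1 \<and> even h2)"
      by (rule even_product_coeffs) (rule 2, rule that(4-8), simp add: x algebra_simps)+
    then show ?thesis
    proof (elim disjE conjE evenE)
      fix y0 y1 y2 assume "x0 = 2 * y0" "x1 = 2 * y1" "x2 = 2 * y2"
      then show ?thesis by (intro scale[of 4 1 _ y0 _ y1 _ y2 _ h0 _ h1 _ h2]) (simp_all add: x)
    next
      fix y0 y1 y2 assume "h0 = 2 * y0" "h1 = 2 * y1" "h2 = 2 * y2"
      then show ?thesis by (intro scale[of 2 2 _ x0 _ x1 _ x2 _ y0 _ y1 _ y2]) (simp_all add: x)
    qed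
  qed
  have e: "even n" if "4 dvd n" for n :: int using that by presburger
  from even_product_coeffs[OF assms[THEN e]]
  show ?thesis
  proof (elim disjE conjE)
    assume "even g0" "even g1" "even g2"
    then show ?thesis using assms by (intro half)
  next
    assume "even h0" "even h1" "even h2"
    then have "2 ^ 16 dvd quad_disc h2 h1 h0 * quad_disc g2 g1 g0 *
      (h0 * g0 * quad_res h2 h1 h0 g2 g1 g0)\<^sup>2"
      using assms by (intro half) (simp_all add: mult.commute add.commute add.left_commute)
    also have "quad_res h2 h1 h0 g2 g1 g0 = quad_res g2 g1 g0 h2 h1 h0"
      by (rule quad_res_commute)
    finally show ?thesis by (simp add: mult_ac)
  qed
qed

lemma int_mult_eq_4_cases:
  fixes x y :: int
  assumes "x * y = 4"
  shows "(x, y) \<in> {(1, 4), (2, 2), (4, 1), (-1, -4), (-2, -2), (-4, -1)}"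
proof -
  have "x dvd 4" using assms by (metis dvd_triv_left)
  then have "\<bar>x\<bar> \<le> 4" using zdvd_imp_le[of "\<bar>x\<bar>" 4] by simp
  then have "x \<in> {-4, -3, -2, -1, 0, 1, 2, 3, 4}" by auto
  then show ?thesis
    by (elim insertE emptyE) (use assms in \<open>simp_all, presburger+\<close>)
qed

text \<open>Comparing coefficients makes \<open>q0\<close> even, and the parities of
  \<open>q2\<close> and \<open>q1\<close> decide. If \<open>q2\<close> is odd, the leading
  coefficients are 1 and 4 up to order and a common sign. If both are even, 4 divides every
  coefficient of the product, and \<open>2 ^ 16\<close> would divide \<open>256 * p\<close>. If only
  \<open>q1\<close> is odd, the coefficients of the product contradict each other.\<close>

lemma no_root_denominator_1:
  fixes P Q :: "int poly" and g0 g1 g2 h0 h1 h2 p :: int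
  assumes p: "prime p" "odd p"
    and PQ: "degree P = 5" "monic P" "degree Q \<le> 2"
    and F: "[:0, 1:] * [:g0, g1, g2:] * [:h0, h1, h2:] = Polynomial.smult 4 P + Q\<^sup>2"
    and ns: "\<And>k. quad_disc g2 g1 g0 \<noteq> k\<^sup>2" "\<And>k. quad_disc h2 h1 h0 \<noteq> k\<^sup>2"
    and eq: "\<bar>quad_disc g2 g1 g0 * quad_disc h2 h1 h0 *
      (g0 * h0 * quad_res g2 g1 g0 h2 h1 h0)\<^sup>2\<bar> = 256 * p"
  shows False
proof -
  obtain p0 p1 p2 p3 p4 where P: "P = [:p0, p1, p2, p3, p4, 1:]"
    using monic_quintic_eq[OF PQ(1,2)] by blast
  obtain q0 q1 q2 where Q: "Q = [:q0, q1, q2:]"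
    using poly_eq_of_degree_le_2[OF PQ(3)] by blast
  have co: "0 = 4 * p0 + q0\<^sup>2" "g0 * h0 = 4 * p1 + 2 * q0 * q1"
    "g0 * h1 + g1 * h0 = 4 * p2 + q1\<^sup>2 + 2 * q0 * q2"
    "g0 * h2 + g1 * h1 + g2 * h0 = 4 * p3 + 2 * q1 * q2"
    "g1 * h2 + g2 * h1 = 4 * p4 + q2\<^sup>2" "g2 * h2 = 4"
    using F unfolding P Q by (simp_all add: power2_eq_square algebra_simps)
  have "q0\<^sup>2 = 2 * (- 2 * p0)" using co(1) by simp
  then have "even (q0\<^sup>2)" by (metis dvd_triv_left)
  then obtain k0 where q0: "q0 = 2 * k0" by auto
  have d1: "4 dvd g0 * h0" unfolding co(2) q0 by simp
  note gh = int_mult_eq_4_cases[OF co(6)]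
  show False
  proof (cases "even q2")
    case False
    then have odd4: "odd (g1 * h2 + g2 * h1)" using co(5) by simp
    \<comment> \<open>The normalized situation; exchanging the quadratics or negating both preserves
      all its hypotheses and yields the four cases below.\<close>
    have *: False if "(a, e) = (1, 4)" "odd (b * f + a * e')" "4 dvd c * f'"
      "\<And>k. quad_disc a b c \<noteq> k\<^sup>2" "\<And>k. quad_disc e e' f' \<noteq> k\<^sup>2"
      "\<bar>quad_disc a b c * quad_disc e e' f' * (c * f' * quad_res a b c e e' f')\<^sup>2\<bar> = 256 * p" "f = e"
      for a b c e e' f f'
      using no_root_denominator_1_leads_1_4[OF p, of e' c f' b] that by simp
    have eq': "\<bar>quad_disc h2 h1 h0 * quad_disc g2 g1 g0 * (h0 * g0 * quad_res h2 h1 h0 g2 g1 g0)\<^sup>2\<bar> = 256 * p"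
      unfolding eq[symmetric] quad_res_commute[of h2] by (simp only: mult.commute)
    have d1': "4 dvd h0 * g0" using d1 by (simp only: mult.commute)
    have odd4': "odd (h1 * g2 + h2 * g1)" using odd4 by (simp add: algebra_simps)
    from gh odd4 consider "(g2, h2) = (1, 4)" | "(h2, g2) = (1, 4)" | "(- g2, - h2) = (1, 4)"
      | "(- h2, - g2) = (1, 4)" by auto
    then show False
    proof cases
      case 1
      show False by (rule *[OF 1 odd4 d1 ns eq refl])
    next
      case 2
      show False by (rule *[OF 2 odd4' d1' ns(2,1) eq' refl])
    next
      case 3
      show False
        by (rule *[OF 3, of "- g1" "- h2" "- h1" "- g0" "- h0"])
           (use odd4 d1 ns eq in \<open>simp_all add: quad_disc_uminus quad_res_uminus\<close>)
    next
      case 4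
      show False
        by (rule *[OF 4, of "- h1" "- g2" "- g1" "- h0" "- g0"])
           (use odd4' d1' ns eq' in \<open>simp_all add: quad_disc_uminus quad_res_uminus\<close>)
    qed
  next
    case True
    then obtain k2 where q2: "q2 = 2 * k2" by (elim evenE)
    have d4: "4 dvd g1 * h2 + g2 * h1" unfolding co(5) q2 by (simp add: power2_eq_square)
    have d3: "4 dvd g0 * h2 + g1 * h1 + g2 * h0" unfolding co(4) q2 by simp
    show False
    proof (cases "even q1")
      case True
      then obtain k1 where q1: "q1 = 2 * k1" by (elim evenE)
      have d2: "4 dvd g0 * h1 + g1 * h0" unfolding co(3) q1 q2 by (simp add: power2_eq_square)
      have "2 ^ 16 dvd \<bar>quad_disc g2 g1 g0 * quad_disc h2 h1 h0 *
        (g0 * h0 * quad_res g2 g1 g0 h2 h1 h0)\<^sup>2\<bar>"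
        unfolding dvd_abs_iff using co(6)
        by (intro dvd_disc_if_4_dvd_product_coeffs d1 d2 d3 d4) simp
      then have "2 ^ 16 dvd 256 * p" unfolding eq .
      then obtain k where "256 * p = 2 ^ 16 * k" by (elim dvdE)
      then have "p = 2 * (128 * k)" by simp
      then show False using p(2) by simp
    next
      case False
      have odd2: "odd (g0 * h1 + g1 * h0)" unfolding co(3) using False by simp
      have half: "even n" if "4 dvd 2 * n" for n :: int using that by presburger
      have e: "even n" if "4 dvd n" for n :: int using that by presburger
      note e3 = e[OF d3] and e4 = e[OF d4]
      \<comment> \<open>If exactly one leading coefficient is even, the two next coefficients of the
        product force that whole quadratic to be even, against \<open>odd2\<close>.\<close>
      from gh consider "even h2" "odd g2" | "even g2" "odd h2"
        | "g2 = 2" "h2 = 2" | "g2 = - 2" "h2 = - 2" by auto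
      then show False
      proof cases
        case 3
        \<comment> \<open>Parity says nothing here; divisibility by 4 is what gives
          \<open>g1\<close> and \<open>h1\<close> the same parity, and \<open>e3\<close> then makes
          both even.\<close>
        have "even (g1 + h1)" using d4 by (intro half) (simp add: 3 algebra_simps)
        then show False using e3 odd2 by (auto simp: 3)
      next
        case 4
        have "4 dvd - (2 * (g1 + h1))" using d4 by (simp add: 4 algebra_simps)
        then have "even (g1 + h1)" by (intro half) (simp only: dvd_minus_iff)
        then show False using e3 odd2 by (auto simp: 4)
      qed (use e3 e4 odd2 in auto)
    qed
  qed
qed

section \<open>Gauss's lemma: factorization over the integers\<close>

lemma rat_poly_clear_denominators:
  "\<exists>m G. m \<noteq> 0 \<and> Polynomial.smult (of_int m) g = (of_int_poly G :: rat poly)"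
proof (induction g)
  case 0
  show ?case by (intro exI[of _ 1] exI[of _ 0]) simp
next
  case (pCons a g)
  then obtain m G where mG: "m \<noteq> 0" "Polynomial.smult (of_int m) g = (of_int_poly G :: rat poly)" by blast
  obtain x y where a: "a = of_int x / of_int y" "y > 0"
    by (metis quotient_of_div quotient_of_denom_pos surj_pair)
  have "Polynomial.smult (of_int (y * m)) (pCons a g) =
      of_int_poly (pCons (x * m) (Polynomial.smult y G))"
    using a mG(2)[symmetric] by (simp add: of_int_hom.map_poly_hom_smult of_int_hom.map_poly_pCons_hom)
  then show ?case using mG(1) a(2) by (intro exI[of _ "y * m"]) auto
qed

lemma rat_poly_primitive_int_poly:
  fixes g :: "rat poly"
  assumes "g \<noteq> 0"
  obtains c G where "c \<noteq> 0" "content G = 1" "g = Polynomial.smult c (of_int_poly G)"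
proof -
  obtain m G where mG: "m \<noteq> 0" "Polynomial.smult (of_int m) g = (of_int_poly G :: rat poly)"
    using rat_poly_clear_denominators by blast
  have "G \<noteq> 0" using mG assms by auto
  have "g = Polynomial.smult (1 / of_int m) (of_int_poly G)"
    using mG by (simp flip: mG(2))
  also have "G = Polynomial.smult (content G) (primitive_part G)" by simp
  also have "(of_int_poly \<dots> :: rat poly) = Polynomial.smult (of_int (content G)) (of_int_poly (primitive_part G))"
    by (rule of_int_hom.map_poly_hom_smult)
  finally have "g = Polynomial.smult (of_int (content G) / of_int m) (of_int_poly (primitive_part G))"
    by simp
  then show thesis using \<open>G \<noteq> 0\<close> mG(1)
    by (intro that[of "of_int (content G) / of_int m" "primitive_part G"]) auto
qed

text \<open>After clearing denominators, \<open>m F = G Q\<close> with \<open>G\<close> primitive.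
  Multiplicativity of the content shows that \<open>m\<close> divides the content of
  \<open>Q\<close>, so it cancels.\<close>

lemma int_poly_factor_of_rat_dvd:
  fixes g :: "rat poly" and F :: "int poly"
  assumes "g dvd of_int_poly F" "F \<noteq> 0"
  obtains c G H where "c \<noteq> 0" "content G = 1" "g = Polynomial.smult c (of_int_poly G)" "F = G * H"
proof -
  have "g \<noteq> 0" using assms by auto
  then obtain c G where G: "c \<noteq> 0" "content G = 1" "g = Polynomial.smult c (of_int_poly G)"
    using rat_poly_primitive_int_poly by blast
  from assms(1) obtain q where q: "of_int_poly F = g * q" by (elim dvdE)
  obtain m Q where mQ: "m \<noteq> 0" "Polynomial.smult (of_int m) (Polynomial.smult c q) = (of_int_poly Q :: rat poly)"
    using rat_poly_clear_denominators by blast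
  have "(of_int_poly (Polynomial.smult m F) :: rat poly) = of_int_poly (G * Q)"
    by (simp add: of_int_hom.map_poly_hom_smult of_int_poly_hom.hom_mult q G(3) mult_ac flip: mQ(2))
  then have eq: "Polynomial.smult m F = G * Q"
    by (simp only: of_int_poly_hom.eq_iff)
  have "content Q = content (G * Q)" by (simp add: content_mult G(2))
  also have "\<dots> = \<bar>m\<bar> * content F" by (simp flip: eq)
  finally have "m dvd content Q" by simp
  then have "[:m:] dvd Q" by (simp add: const_poly_dvd_iff_dvd_content)
  then obtain H where "Q = Polynomial.smult m H" by (auto elim: dvdE)
  with eq have "Polynomial.smult m (F - G * H) = 0" by (simp add: smult_diff_right)
  with mQ(1) have "F = G * H" by simp
  with G show thesis by (rule that)
qed

text \<open>The quadratic formula; it turns uniqueness of the rational root into non-squareness of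
  the discriminants.\<close>

lemma square_quad_disc_imp_root:
  fixes a b c k :: int
  assumes "a \<noteq> 0" "quad_disc a b c = k\<^sup>2"
  shows "poly (of_int_poly [:c, b, a:]) ((of_int k - of_int b) / (2 * of_int a) :: rat) = 0"
proof -
  define x :: rat where "x = (of_int k - of_int b) / (2 * of_int a)"
  have "2 * of_int a * x + of_int b = of_int k" using assms(1) by (simp add: x_def)
  then have "(2 * of_int a * x + of_int b)\<^sup>2 = (of_int (quad_disc a b c) :: rat)"
    by (simp add: assms(2))
  then have "4 * of_int a * (of_int c + x * (of_int b + x * of_int a)) = 0"
    by (simp add: quad_disc_def power2_eq_square algebra_simps)
  then show ?thesis using assms(1)
    by (simp add: of_int_hom.map_poly_pCons_hom flip: x_def)
qed

lemma lin_quad_res_eq_0_of_common_root: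
  fixes l m a b c :: int
  assumes "l \<noteq> 0" "poly (of_int_poly [:c, b, a:]) (- of_int m / of_int l :: rat) = 0"
  shows "lin_quad_res l m a b c = 0"
proof -
  have "of_int (lin_quad_res l m a b c) =
      (of_int l)\<^sup>2 * poly (of_int_poly [:c, b, a:]) (- of_int m / of_int l :: rat)"
    using assms(1) by (simp add: of_int_hom.map_poly_pCons_hom lin_quad_res_def power2_eq_square field_simps)
  then show ?thesis using assms(2) by simp
qed

section \<open>From the Weierstrass equation to the three cases\<close>

lemma wF_of_int_poly:
  "wF (of_int_poly P) (of_int_poly Q) = of_int_poly (Polynomial.smult 4 P + Q\<^sup>2)"
  by (simp add: wF_def of_int_hom.map_poly_hom_smult of_int_hom.map_poly_hom_add
    of_int_poly_hom.hom_mult power2_eq_square)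

text \<open>The root at infinity contributes the square of the leading coefficient 4 to
  \<open>disc6\<close>, so the denominator \<open>2 ^ 12\<close> becomes
  \<open>2 ^ 8\<close>.\<close>

lemma wdisc_linear_quadratic_quadratic:
  fixes P Q :: "int poly" and l m a b c a' b' c' :: int
  assumes F: "Polynomial.smult 4 P + Q\<^sup>2 = [:m, l:] * [:c, b, a:] * [:c', b', a':]"
    and lead: "l * a * a' = 4"
  shows "256 * wdisc (of_int_poly P) (of_int_poly Q) = of_int (quad_disc a b c * quad_disc a' b' c' *
    (lin_quad_res l m a b c * lin_quad_res l m a' b' c' * quad_res a b c a' b' c')\<^sup>2)"
proof -
  have nz: "l \<noteq> 0" "a \<noteq> 0" "a' \<noteq> 0" using lead by auto
  define f :: "rat poly" where "f = [:of_int m, of_int l:] * [:of_int c, of_int b, of_int a:] *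
    [:of_int c', of_int b', of_int a':]"
  have "wF (of_int_poly P) (of_int_poly Q) = of_int_poly (Polynomial.smult 4 P + Q\<^sup>2)"
    by (rule wF_of_int_poly)
  also have "\<dots> = f"
    unfolding F f_def by (simp add: of_int_poly_hom.hom_mult of_int_hom.map_poly_pCons_hom)
  finally have wF: "wF (of_int_poly P) (of_int_poly Q) = f" .
  have deg: "degree f = 5"
    using nz unfolding f_def by (simp add: degree_mult_eq)
  have "lead_coeff f = of_int (l * a * a')"
    using nz unfolding f_def by (simp add: lead_coeff_mult)
  then have lc: "coeff f 5 = 4" by (simp only: deg lead of_int_numeral)
  have "poly_disc f = of_int (quad_disc a b c * quad_disc a' b' c' *
    (lin_quad_res l m a b c * lin_quad_res l m a' b' c' * quad_res a b c a' b' c')\<^sup>2)"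
    unfolding f_def using nz
    by (subst poly_disc_linear_quadratic_quadratic)
       (simp_all add: quad_disc_def quad_res_def lin_quad_res_def)
  then show ?thesis
    by (simp add: wdisc_def disc6_def wF deg lc)
qed

theorem theorem6p1:
  fixes P Q :: "int poly"
  assumes "monic P" and "degree P = 5" and "degree Q \<le> 2"
    and "wdisc (of_int_poly P) (of_int_poly Q) \<noteq> 0"
    and "num_rat_weierstrass (of_int_poly P) (of_int_poly Q) = 2"
    and "has_quadratic_weierstrass (of_int_poly P) (of_int_poly Q)"
    and "globally_minimal P Q"
  shows "\<not> (\<exists>p :: int. prime p \<and> odd p \<and>
            \<bar>wdisc (of_int_poly P) (of_int_poly Q)\<bar> = of_int p)"
proof
  assume "\<exists>p :: int. prime p \<and> odd p \<and> \<bar>wdisc (of_int_poly P) (of_int_poly Q)\<bar> = of_int p"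
  then obtain p :: int where p: "prime p" "odd p"
    and disc: "\<bar>wdisc (of_int_poly P) (of_int_poly Q)\<bar> = of_int p" by blast
  define F where "F = Polynomial.smult 4 P + Q\<^sup>2"
  have "degree (Q\<^sup>2) \<le> 4" using degree_power_le[of Q 2] assms(3) by linarith
  then have deg: "degree F = 5" and lead: "lead_coeff F = 4"
    using assms(1,2) by (simp_all add: F_def degree_add_eq_left coeff_eq_0)
  have "F \<noteq> 0" using deg by auto
  have wF: "wF (of_int_poly P) (of_int_poly Q) = of_int_poly F"
    unfolding F_def by (rule wF_of_int_poly)
  \<comment> \<open>One of the two rational Weierstrass points is at infinity because the degree is
    5.\<close>
  have "card {r :: rat. poly (of_int_poly F) r = 0} = 1"
    using assms(5) deg by (simp add: num_rat_weierstrass_def wF)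
  then obtain r :: rat where r: "{r. poly (of_int_poly F) r = 0} = {r}"
    by (auto simp: card_1_singleton_iff)
  then have "[:- r, 1:] dvd of_int_poly F" by (auto simp: poly_eq_0_iff_dvd)
  then obtain e L K where L: "e \<noteq> 0" "content L = 1" "[:- r, 1:] = Polynomial.smult e (of_int_poly L)" "F = L * K"
    using \<open>F \<noteq> 0\<close> int_poly_factor_of_rat_dvd by metis
  have nz: "L \<noteq> 0" "K \<noteq> 0" using L \<open>F \<noteq> 0\<close> by auto
  have degL: "degree L = 1"
    using arg_cong[OF L(3), of degree] L(1) by simp
  obtain g :: "rat poly" where g: "irreducible g" "degree g = 2" "g dvd of_int_poly F"
    using assms(6) by (auto simp: has_quadratic_weierstrass_def wF)
  have "prime_elem g" using g(1) by (rule field_poly_irreducible_imp_prime)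
  moreover have "g dvd of_int_poly L * of_int_poly K"
    using g(3) by (simp add: L(4) of_int_poly_hom.hom_mult)
  moreover have "\<not> g dvd of_int_poly L"
    using dvd_imp_degree_le[of g "of_int_poly L"] nz g(2) degL by auto
  ultimately have "g dvd of_int_poly K" using prime_elem_dvd_mult_iff by blast
  then obtain e' G H where G: "e' \<noteq> 0" "g = Polynomial.smult e' (of_int_poly G)" "K = G * H"
    using nz(2) int_poly_factor_of_rat_dvd by metis
  have degG: "degree G = 2" using arg_cong[OF G(2), of degree] G(1) g(2) by simp
  have nz': "G \<noteq> 0" "H \<noteq> 0" using G nz by auto
  have degH: "degree H = 2"
    using deg nz nz' degL degG unfolding L(4) G(3) by (simp add: degree_mult_eq)
  \<comment> \<open>The sign of \<open>L\<close> is moved into \<open>G\<close>, so that the leading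
    coefficient of \<open>L\<close> becomes positive.\<close>
  have "\<exists>L G. F = L * G * H \<and> content L = 1 \<and> degree L = 1 \<and> degree G = 2 \<and>
    lead_coeff L > 0 \<and> poly (of_int_poly L) r = 0"
  proof -
    have root: "poly (of_int_poly L) r = 0"
      using arg_cong[OF L(3), of "\<lambda>f. poly f r"] L(1) by simp
    show ?thesis
    proof (cases "lead_coeff L > 0")
      case True
      then show ?thesis using L G degL degG root by (intro exI[of _ L] exI[of _ G]) (simp add: mult.assoc)
    next
      case False
      then have "lead_coeff L < 0" using nz by (simp add: not_less order.order_iff_strict)
      moreover have "content (- L) = 1" using content_smult[of "- 1" L] L(2) by simp
      ultimately show ?thesis using L G degL degG root
        by (intro exI[of _ "- L"] exI[of _ "- G"])
           (simp add: mult.assoc of_int_poly_hom.hom_uminus)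
    qed
  qed
  then obtain L G where LG: "F = L * G * H" "content L = 1" "degree L = 1" "degree G = 2"
    "lead_coeff L > 0" "poly (of_int_poly L) r = 0" by blast
  obtain m l where Lml: "L = [:m, l:]" using LG(3) degree1_coeffs by blast
  obtain c b a where Gabc: "G = [:c, b, a:]" using LG(4) poly_eq_of_degree_le_2[of G] by auto
  obtain c' b' a' where Habc: "H = [:c', b', a':]" using degH poly_eq_of_degree_le_2[of H] by auto
  have "l > 0" using LG(3,5) Lml by (auto split: if_splits)
  have leads: "l * a * a' = 4"
    using lead LG(3,4) degH unfolding LG(1) lead_coeff_mult Lml Gabc Habc
    by (auto simp: numeral_2_eq_2 split: if_splits)
  then have a0: "a \<noteq> 0" "a' \<noteq> 0" by auto
  have F_eq: "Polynomial.smult 4 P + Q\<^sup>2 = [:m, l:] * [:c, b, a:] * [:c', b', a':]"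
    using LG(1) unfolding F_def Lml Gabc Habc .
  have r_eq: "r = - of_int m / of_int l"
    using LG(6) \<open>l > 0\<close> unfolding Lml by (simp add: of_int_hom.map_poly_pCons_hom field_simps)
  define A where "A = lin_quad_res l m a b c"
  define B where "B = lin_quad_res l m a' b' c'"
  define R where "R = quad_res a b c a' b' c'"
  have "of_int \<bar>quad_disc a b c * quad_disc a' b' c' * (A * B * R)\<^sup>2\<bar> = (of_int (256 * p) :: rat)"
    unfolding of_int_abs A_def B_def R_def wdisc_linear_quadratic_quadratic[OF F_eq leads, symmetric]
    using disc by (simp add: abs_mult)
  then have eq: "\<bar>quad_disc a b c * quad_disc a' b' c' * (A * B * R)\<^sup>2\<bar> = 256 * p"
    by (simp only: of_int_eq_iff)
  have "A \<noteq> 0" "B \<noteq> 0" using eq p(1) by auto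
  have root_unique: "x = - of_int m / of_int l"
    if "poly (of_int_poly G) x = 0 \<or> poly (of_int_poly H) x = 0" for x :: rat
  proof -
    have "poly (of_int_poly F) x = 0"
      using that by (auto simp: LG(1) of_int_poly_hom.hom_mult)
    then have "x = r" using r by blast
    then show ?thesis by (simp only: r_eq)
  qed
  \<comment> \<open>A square discriminant gives a rational root of the quadratic. It must be the
    unique rational root of \<open>F\<close>, which \<open>L\<close> has too, so the resultant
    \<open>A\<close> would vanish. The same argument with \<open>B\<close> treats the cofactor
    \<open>H\<close>, whose irreducibility is not assumed.\<close>
  have ns: "quad_disc a b c \<noteq> k\<^sup>2" for k
  proof
    assume "quad_disc a b c = k\<^sup>2"
    from square_quad_disc_imp_root[OF a0(1) this]
    have "poly (of_int_poly [:c, b, a:]) (- of_int m / of_int l :: rat) = 0"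
      using root_unique unfolding Gabc by metis
    from lin_quad_res_eq_0_of_common_root[OF _ this] \<open>A \<noteq> 0\<close> \<open>l > 0\<close>
    show False by (simp add: A_def)
  qed
  have ns': "quad_disc a' b' c' \<noteq> k\<^sup>2" for k
  proof
    assume "quad_disc a' b' c' = k\<^sup>2"
    from square_quad_disc_imp_root[OF a0(2) this]
    have "poly (of_int_poly [:c', b', a':]) (- of_int m / of_int l :: rat) = 0"
      using root_unique unfolding Habc by metis
    from lin_quad_res_eq_0_of_common_root[OF _ this] \<open>B \<noteq> 0\<close> \<open>l > 0\<close>
    show False by (simp add: B_def)
  qed
  \<comment> \<open>Primitivity of \<open>L\<close> says that the root is in lowest terms at
    2.\<close>
  have odd_m: "odd m" if "even l"
  proof
    assume "even m"
    with that have "[:2:] dvd L" unfolding Lml by (simp add: const_poly_dvd_iff coeff_pCons split: nat.splits)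
    then have "2 dvd content L" by (simp add: const_poly_dvd_iff_dvd_content)
    then show False using LG(2) by simp
  qed
  have "l * (a * a') = 4" using leads by (simp add: mult.assoc)
  from int_mult_eq_4_cases[OF this] \<open>l > 0\<close> consider "l = 1" | "l = 2" | "l = 4" "a * a' = 1" by auto
  then show False
  proof cases
    case 1
    \<comment> \<open>Substituting \<open>x - m\<close> moves the root \<open>- m\<close> to 0;
      discriminants and resultants are invariant under translation.\<close>
    define s where "s = [:- m, 1:]"
    have s: "degree s = 1" "lead_coeff s = 1" by (simp_all add: s_def)
    define g0 g1 h0 h1 where "g0 = c - b * m + a * m\<^sup>2" and "g1 = b - 2 * a * m"
      and "h0 = c' - b' * m + a' * m\<^sup>2" and "h1 = b' - 2 * a' * m"
    have "Polynomial.smult 4 (P \<circ>\<^sub>p s) + (Q \<circ>\<^sub>p s)\<^sup>2 = (L * G * H) \<circ>\<^sub>p s"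
      unfolding LG(1)[symmetric] F_def
      by (simp add: pcompose_add pcompose_smult pcompose_mult power2_eq_square)
    also have "\<dots> = [:0, 1:] * [:g0, g1, a:] * [:h0, h1, a':]"
      unfolding pcompose_mult Lml Gabc Habc 1 s_def g0_def g1_def h0_def h1_def
      by (simp add: pcompose_pCons power2_eq_square algebra_simps)
    finally have F': "[:0, 1:] * [:g0, g1, a:] * [:h0, h1, a':] =
      Polynomial.smult 4 (P \<circ>\<^sub>p s) + (Q \<circ>\<^sub>p s)\<^sup>2" ..
    have D: "quad_disc a g1 g0 = quad_disc a b c" "quad_disc a' h1 h0 = quad_disc a' b' c'"
      by (simp_all add: quad_disc_def g0_def g1_def h0_def h1_def power2_eq_square algebra_simps)
    have AB: "A = g0" "B = h0"
      by (simp_all add: A_def B_def lin_quad_res_def g0_def h0_def 1)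
    have R: "quad_res a g1 g0 a' h1 h0 = R"
      by (simp add: R_def quad_res_def g0_def g1_def h0_def h1_def power2_eq_square algebra_simps)
    show False
    proof (rule no_root_denominator_1[OF p _ _ _ F'])
      show "degree (P \<circ>\<^sub>p s) = 5" "degree (Q \<circ>\<^sub>p s) \<le> 2" using assms(2,3) s by simp_all
      show "monic (P \<circ>\<^sub>p s)" using lead_coeff_comp[of s P] s assms(1) by simp
    qed (use ns ns' eq D AB R in simp_all)
  next
    case 2
    obtain p0 p1 p2 p3 p4 where P: "P = [:p0, p1, p2, p3, p4, 1:]"
      using monic_quintic_eq[OF assms(2,1)] by blast
    obtain q0 q1 q2 where Q: "Q = [:q0, q1, q2:]"
      using poly_eq_of_degree_le_2[OF assms(3)] by blast
    have "poly (of_int_poly F) r = 0" using r by auto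
    then have "4 * poly (of_int_poly P) r + (poly (of_int_poly Q) r)\<^sup>2 = 0"
      by (simp add: F_def of_int_hom.map_poly_hom_smult of_int_hom.map_poly_hom_add
        of_int_poly_hom.hom_mult power2_eq_square)
    moreover define M where "M = - m"
    moreover have M: "of_int M = 2 * r" using r_eq 2 by (simp add: M_def)
    \<comment> \<open>The factor 32 clears the denominators of \<open>P\<close> at \<open>r\<close>,
      which is half of \<open>M\<close>.\<close>
    have "of_int (4 * (M ^ 5 + 2 * p4 * M ^ 4 + 4 * p3 * M ^ 3 + 8 * p2 * M\<^sup>2 +
      16 * p1 * M + 32 * p0) + 2 * (q2 * M\<^sup>2 + 2 * q1 * M + 4 * q0)\<^sup>2) =
      32 * (4 * poly (of_int_poly P) r + (poly (of_int_poly Q) r)\<^sup>2)"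
      unfolding P Q
      by (simp add: M of_int_hom.map_poly_pCons_hom power_numeral_reduce algebra_simps)
    ultimately have "of_int (4 * (M ^ 5 + 2 * p4 * M ^ 4 + 4 * p3 * M ^ 3 + 8 * p2 * M\<^sup>2 +
      16 * p1 * M + 32 * p0) + 2 * (q2 * M\<^sup>2 + 2 * q1 * M + 4 * q0)\<^sup>2) = (0 :: rat)"
      by (simp only: mult_zero_right)
    then have "4 * (M ^ 5 + 2 * p4 * M ^ 4 + 4 * p3 * M ^ 3 + 8 * p2 * M\<^sup>2 +
      16 * p1 * M + 32 * p0) + 2 * (q2 * M\<^sup>2 + 2 * q1 * M + 4 * q0)\<^sup>2 = 0"
      by (simp only: of_int_eq_0_iff)
    moreover have "odd M" using odd_m 2 by (simp add: M_def)
    ultimately show False using no_root_denominator_2 by blast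
  next
    case 3
    show False
      using no_root_denominator_4[OF p 3(2), of "- m" b c b' c'] odd_m eq
      by (simp add: A_def B_def R_def 3)
  qed
qed

end
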